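(* Let $h_1,h_2\ge 0$ be real numbers and $\mathbf h=(h_1,h_2)$. For every $x,t>0$ and every integer $k\ge 0$, $$\mathbb{P}\big(L^{\mathbf h}_{(x,t)}\le k\big)=\mathbb{P}\big(L_{(x-h_1k,\;t-h_2k)}\le k\big).$$
   Context: Let $\Xi$ be a homogeneous Poisson point process with intensity $1$ in $(0,+\infty)^2$. For $\mathbf h=(h_1,h_2)$ with $h_1,h_2\ge 0$ real, write $(y,s)\stackrel{\mathbf h}{\prec}(y',s')$ if $y+h_1\le y'$ and $s+h_2\le s'$. For $x,t>0$, $L^{\mathbf h}_{(x,t)}$ is the maximal integer $L\ge 0$ such that there are points $(y_1,s_1),\dots,(y_L,s_L)\in\Xi$ with $0<y_1<\dots<y_L<x$, $0<s_1<\dots<s_L<t$ and $(y_1,s_1)\stackrel{\mathbf h}{\prec}(y_2,s_2)\stackrel{\mathbf h}{\prec}\dots\stackrel{\mathbf h}{\prec}(y_L,s_L)$. We write $L_{(x,t)}:=L^{(0,0)}_{(x,t)}$ (length of the longest increasing path, no gap constraint), with the convention $L_{(y,s)}=0$ whenever $y\le 0$ or $s\le 0$. *)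

theory Defs
  imports "HOL-Probability.Probability"
begin

section \<open>Homogeneous Poisson processes\<close>

text \<open>
  A homogeneous Poisson process with intensity \<open>c\<close> in a region \<open>D\<close> of the plane is a random
  locally finite set of points of \<open>D\<close>. Local finiteness is required for every outcome, so that all
  counts below are genuine. The Poisson weights are written out because \<^term>\<open>poisson_pmf\<close> needs
  a positive rate, while sets of measure zero have rate \<open>0\<close> (here \<open>0 ^ 0 = 1\<close>).
\<close>

locale homogeneous_poisson_process = prob_space M
  for M :: "'w measure" +
  fixes c :: real
    and D :: "(real \<times> real) set"
    and \<Xi> :: "'w \<Rightarrow> (real \<times> real) set"
  assumes points_in_region: "\<And>\<omega>. \<omega> \<in> space M \<Longrightarrow> \<Xi> \<omega> \<subseteq> D"
    and locally_finite: "\<And>\<omega> B. \<omega> \<in> space M \<Longrightarrow> bounded B \<Longrightarrow> finite (\<Xi> \<omega> \<inter> B)"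
    and count_measurable:
      "\<And>B. B \<in> sets borel \<Longrightarrow> bounded B \<Longrightarrow> B \<subseteq> D \<Longrightarrow>
        random_variable (count_space UNIV) (\<lambda>\<omega>. card (\<Xi> \<omega> \<inter> B))"
    and count_poisson:
      "\<And>B n. B \<in> sets borel \<Longrightarrow> bounded B \<Longrightarrow> B \<subseteq> D \<Longrightarrow>
        prob {\<omega> \<in> space M. card (\<Xi> \<omega> \<inter> B) = n} =
          (c * measure lborel B) ^ n / fact n * exp (- (c * measure lborel B))"
    and count_indep:
      "\<And>(B :: nat \<Rightarrow> (real \<times> real) set) m.
        (\<And>i. i < m \<Longrightarrow> B i \<in> sets borel \<and> bounded (B i) \<and> B i \<subseteq> D) \<Longrightarrow>
        disjoint_family_on B {..<m} \<Longrightarrow>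
        indep_vars (\<lambda>_. count_space UNIV) (\<lambda>i \<omega>. card (\<Xi> \<omega> \<inter> B i)) {..<m}"

abbreviation quadrant :: "(real \<times> real) set" where
  "quadrant \<equiv> {0<..} \<times> {0<..}"


section \<open>Longest increasing paths with gaps\<close>

definition gap_prec :: "real \<times> real \<Rightarrow> real \<times> real \<Rightarrow> real \<times> real \<Rightarrow> bool" where
  "gap_prec h p q \<longleftrightarrow> fst p + fst h \<le> fst q \<and> snd p + snd h \<le> snd q"

definition gap_path ::
  "(real \<times> real) set \<Rightarrow> real \<times> real \<Rightarrow> real \<times> real \<Rightarrow> (real \<times> real) list \<Rightarrow> bool" where
  "gap_path A h z ps \<longleftrightarrow>
     set ps \<subseteq> A \<and>
     set ps \<subseteq> {0<..<fst z} \<times> {0<..<snd z} \<and>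
     sorted_wrt (<) (map fst ps) \<and>
     sorted_wrt (<) (map snd ps) \<and>
     successively (gap_prec h) ps"

definition longest_gap_path :: "(real \<times> real) set \<Rightarrow> real \<times> real \<Rightarrow> real \<times> real \<Rightarrow> nat" where
  "longest_gap_path A h z = (GREATEST L. \<exists>ps. length ps = L \<and> gap_path A h z ps)"

abbreviation longest_path :: "(real \<times> real) set \<Rightarrow> real \<times> real \<Rightarrow> nat" where
  "longest_path A z \<equiv> longest_gap_path A (0, 0) z"

text \<open>
  For locally finite \<open>A\<close> the maximum is attained, so \<^const>\<open>Greatest\<close> is not a junk value.
\<close>

lemma gap_path_length_le:
  assumes "finite (A \<inter> {0<..<fst z} \<times> {0<..<snd z})" and "gap_path A h z ps"
  shows "length ps \<le> card (A \<inter> {0<..<fst z} \<times> {0<..<snd z})"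
proof -
  have "distinct (map fst ps)"
    using assms(2) by (auto simp: gap_path_def strict_sorted_iff)
  then have "length ps = card (set ps)"
    by (simp add: distinct_map distinct_card)
  also have "\<dots> \<le> card (A \<inter> {0<..<fst z} \<times> {0<..<snd z})"
    using assms by (intro card_mono) (auto simp: gap_path_def)
  finally show ?thesis .
qed

lemma longest_gap_path_attained:
  assumes "finite (A \<inter> {0<..<fst z} \<times> {0<..<snd z})"
  shows "\<exists>ps. length ps = longest_gap_path A h z \<and> gap_path A h z ps"
    and "gap_path A h z ps \<Longrightarrow> length ps \<le> longest_gap_path A h z"
proof -
  let ?P = "\<lambda>L. \<exists>ps. length ps = L \<and> gap_path A h z ps"
  have bound: "\<forall>L. ?P L \<longrightarrow> L \<le> card (A \<inter> {0<..<fst z} \<times> {0<..<snd z})"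
    using gap_path_length_le[OF assms] by blast
  have "?P 0"
    by (intro exI[of _ "[]"]) (simp add: gap_path_def)
  from GreatestI_nat[of ?P, OF this] bound show "?P (longest_gap_path A h z)"
    unfolding longest_gap_path_def by blast
  assume "gap_path A h z ps"
  then have "?P (length ps)" by blast
  from Greatest_le_nat[of ?P, OF this] bound show "length ps \<le> longest_gap_path A h z"
    unfolding longest_gap_path_def by blast
qed

text \<open>
  The convention that the length is \<open>0\<close> for degenerate rectangles needs no separate clause.
\<close>

lemma longest_gap_path_degenerate:
  assumes "fst z \<le> 0 \<or> snd z \<le> 0"
  shows "longest_gap_path A h z = 0"
proof -
  have empty: "{0<..<fst z} \<times> {0<..<snd z} = {}"
    using assms by auto
  then obtain ps where "length ps = longest_gap_path A h z" "gap_path A h z ps"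
    using longest_gap_path_attained(1)[of A z h] by auto
  moreover have "ps = []"
    using calculation(2) empty by (simp add: gap_path_def)
  ultimately show ?thesis by simp
qed

end

theory Submission
  imports Defs
begin

text \<open>
  A path with gaps can be found by exploring the quadrant from the lower left. The points where a path
  can start open an up-closed region, in which the second point of a path would lie if there were no
  gap constraint; with the constraint it must lie in the translate of that region by \<open>h\<close>. Which region
  is opened depends on the points outside it only, up to its boundary, so the points in the translate
  are still a fresh Poisson process. Moving this process back by \<open>h\<close> turns the search for a second
  point into the search without a gap, while the target \<open>(x, t)\<close> moves by \<open>-h\<close>. A path of \<open>k + 1\<close> points
  has \<open>k\<close> gaps, so after \<open>k\<close> such moves the event that a path of \<open>k + 1\<close> points with gaps lies below
  \<open>(x, t)\<close> has become the event that an increasing path of \<open>k + 1\<close> points lies below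
  \<open>(x - h\<^sub>1 k, t - h\<^sub>2 k)\<close>. The theorem is the identity of the complementary probabilities.

  The exploration is carried out on the grid of mesh \<open>1/n\<close>, where the occupied cells form a random set
  with independent elements and the strong Markov property becomes independence of disjoint
  sets of cells (\<open>beyond_eq_iff_outside\<close>, \<open>has_chain_resample\<close>). The identity then holds exactly on every
  grid, for gaps and boxes measured in cells (\<open>has_chain_expectation_gap\<close>).

  In the limit, \<open>eventually_has_chain_iff\<close> shows that a sufficiently fine grid has the same chains as
  the point configuration has paths. For the original box this holds for every outcome, which
  also gives measurability of the path length. For the shrunk box it holds unless a point lies on
  the vertical or horizontal line through the corner of that box, which has probability zero. Convergence of the
  probabilities follows by dominated convergence.
\<close>

section \<open>Random subsets with independent elements\<close>

text \<open>
  The expectation of \<open>f\<close> at a random subset of the finite set \<open>G\<close> that contains each element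
  independently with probability \<open>p\<close>. Written as a finite sum, independence, marginals and
  relabelling become identities between sums over power sets.
\<close>

definition bernoulli_expectation :: "real \<Rightarrow> 'a set \<Rightarrow> ('a set \<Rightarrow> real) \<Rightarrow> real" where
  "bernoulli_expectation p G f = (\<Sum>S\<in>Pow G. (\<Prod>c\<in>G. if c \<in> S then p else 1 - p) * f S)"

lemma bernoulli_expectation_cong:
  assumes "\<And>S. S \<subseteq> G \<Longrightarrow> f S = g S"
  shows "bernoulli_expectation p G f = bernoulli_expectation p G g"
  unfolding bernoulli_expectation_def using assms by (intro sum.cong) auto

lemma bernoulli_expectation_sum:
  "bernoulli_expectation p G (\<lambda>S. \<Sum>i\<in>I. f i S) = (\<Sum>i\<in>I. bernoulli_expectation p G (f i))"
  unfolding bernoulli_expectation_def by (subst sum.swap) (simp add: sum_distrib_left)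

lemma bernoulli_expectation_mult_right:
  "bernoulli_expectation p G (\<lambda>S. f S * r) = bernoulli_expectation p G f * r"
  unfolding bernoulli_expectation_def by (simp add: sum_distrib_right mult.assoc)

lemma bernoulli_expectation_Un:
  assumes "finite A" "finite B" "A \<inter> B = {}"
  shows "bernoulli_expectation p (A \<union> B) (\<lambda>S. f (S \<inter> A) * g (S \<inter> B)) =
    bernoulli_expectation p A f * bernoulli_expectation p B g"
proof -
  let ?w = "\<lambda>G S. \<Prod>c\<in>G. if c \<in> S then p else 1 - p"
  have w: "?w (A \<union> B) (S \<union> T) = ?w A S * ?w B T" if "S \<subseteq> A" "T \<subseteq> B" for S T
    unfolding prod.union_disjoint[OF assms]
    using that assms(3) by (intro arg_cong2[where f = "(*)"] prod.cong) auto
  have "bernoulli_expectation p A f * bernoulli_expectation p B g =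
      (\<Sum>(S, T)\<in>Pow A \<times> Pow B. (?w A S * f S) * (?w B T * g T))"
    unfolding bernoulli_expectation_def sum_product sum.cartesian_product ..
  also have "\<dots> = (\<Sum>S\<in>Pow (A \<union> B). ?w (A \<union> B) S * (f (S \<inter> A) * g (S \<inter> B)))"
  proof (rule sum.reindex_bij_witness[where i = "\<lambda>S. (S \<inter> A, S \<inter> B)" and j = "\<lambda>(S, T). S \<union> T"],
      goal_cases)
    case (5 ST)
    then obtain S T where ST: "ST = (S, T)" "S \<subseteq> A" "T \<subseteq> B" by auto
    have "(S \<union> T) \<inter> A = S" "(S \<union> T) \<inter> B = T" using ST assms(3) by auto
    then show ?case using w[OF ST(2,3)] by (simp add: ST(1))
  qed (use assms(3) in auto)
  finally show ?thesis unfolding bernoulli_expectation_def by simp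
qed

lemma bernoulli_expectation_const:
  assumes "finite G"
  shows "bernoulli_expectation p G (\<lambda>_. r) = r"
proof -
  have "bernoulli_expectation p G (\<lambda>_. 1) = 1"
    using assms
  proof induction
    case empty
    then show ?case by (simp add: bernoulli_expectation_def)
  next
    case (insert c G)
    have "bernoulli_expectation p {c} (\<lambda>_. 1) = 1"
      by (simp add: bernoulli_expectation_def Pow_insert)
    then show ?case
      using bernoulli_expectation_Un[of "{c}" G p "\<lambda>_. 1" "\<lambda>_. 1"] insert by simp
  qed
  then show ?thesis
    using bernoulli_expectation_mult_right[of p G "\<lambda>_. 1" r] by simp
qed

lemma bernoulli_expectation_restrict:
  assumes "finite G" "B \<subseteq> G"
  shows "bernoulli_expectation p G (\<lambda>S. f (S \<inter> B)) = bernoulli_expectation p B f"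
proof -
  have "finite B" "finite (G - B)" "B \<inter> (G - B) = {}" "B \<union> (G - B) = G"
    using assms finite_subset by auto
  then show ?thesis
    using bernoulli_expectation_Un[of B "G - B" p f "\<lambda>_. 1"]
    by (simp add: bernoulli_expectation_const)
qed

text \<open>
  Independence for a split of \<open>G\<close> that is described by a set \<open>W\<close> which may stick out of \<open>G\<close>: one
  factor looks only outside \<open>W\<close>, the other only inside.
\<close>

lemma bernoulli_expectation_indep:
  assumes "finite G"
    and f: "\<And>S. S \<subseteq> G \<Longrightarrow> f (S - W) = f S"
    and g: "\<And>S. S \<subseteq> G \<Longrightarrow> g (S \<inter> W) = g S"
  shows "bernoulli_expectation p G (\<lambda>S. f S * g S) =
    bernoulli_expectation p G f * bernoulli_expectation p G g"
proof -
  have f': "f (S \<inter> (G - W)) = f S" and g': "g (S \<inter> (G \<inter> W)) = g S" if "S \<subseteq> G" for S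
  proof -
    have "S \<inter> (G - W) = S - W" "S \<inter> (G \<inter> W) = S \<inter> W" using that by auto
    then show "f (S \<inter> (G - W)) = f S" "g (S \<inter> (G \<inter> W)) = g S" using f g that by auto
  qed
  have "bernoulli_expectation p G (\<lambda>S. f S * g S) =
      bernoulli_expectation p ((G - W) \<union> (G \<inter> W)) (\<lambda>S. f (S \<inter> (G - W)) * g (S \<inter> (G \<inter> W)))"
    using f' g' by (auto simp: Un_Diff_Int intro!: bernoulli_expectation_cong)
  also have "\<dots> = bernoulli_expectation p (G - W) f * bernoulli_expectation p (G \<inter> W) g"
    using assms(1) by (intro bernoulli_expectation_Un) auto
  also have "bernoulli_expectation p (G - W) f = bernoulli_expectation p G f"
    using bernoulli_expectation_restrict[of G "G - W" p f] assms(1) f'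
    by (subst bernoulli_expectation_cong[of G f "\<lambda>S. f (S \<inter> (G - W))"]) auto
  also have "bernoulli_expectation p (G \<inter> W) g = bernoulli_expectation p G g"
    using bernoulli_expectation_restrict[of G "G \<inter> W" p g] assms(1) g'
    by (subst bernoulli_expectation_cong[of G g "\<lambda>S. g (S \<inter> (G \<inter> W))"]) auto
  finally show ?thesis .
qed

lemma bernoulli_expectation_image:
  assumes "inj_on \<phi> G"
  shows "bernoulli_expectation p (\<phi> ` G) f = bernoulli_expectation p G (\<lambda>S. f (\<phi> ` S))"
proof -
  have "(\<Prod>c\<in>\<phi> ` G. if c \<in> \<phi> ` S then p else 1 - p) = (\<Prod>c\<in>G. if c \<in> S then p else 1 - p)"
    if "S \<subseteq> G" for S
    unfolding prod.reindex[OF assms] o_def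
    using that assms by (intro prod.cong) (auto dest: inj_onD)
  moreover have "inj_on (image \<phi>) (Pow G)"
    using assms by (rule inj_on_image_Pow)
  ultimately show ?thesis
    unfolding bernoulli_expectation_def image_Pow_surj[OF refl, symmetric]
    by (subst sum.reindex) auto
qed

section \<open>Chains of cells and their exploration\<close>

definition up_closed :: "(nat \<times> nat) set \<Rightarrow> bool" where
  "up_closed W \<longleftrightarrow> (\<forall>z\<in>W. \<forall>z'. fst z \<le> fst z' \<longrightarrow> snd z \<le> snd z' \<longrightarrow> z' \<in> W)"

text \<open>
  The cells strictly above and to the right of some cell of \<open>S \<inter> U\<close>. These are the cells where,
  before any gap is added, a chain in \<open>S\<close> that starts in \<open>U\<close> can continue.
\<close>

definition beyond :: "(nat \<times> nat) set \<Rightarrow> (nat \<times> nat) set \<Rightarrow> (nat \<times> nat) set" where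
  "beyond U S = {z. \<exists>p\<in>S \<inter> U. fst p < fst z \<and> snd p < snd z}"

text \<open>
  \<open>S\<close> contains \<open>k + 1\<close> cells, the first one in \<open>U\<close>, such that each exceeds its predecessor by more
  than \<open>a\<close> in both coordinates (\<open>has_chain_iff_list\<close>). The recursion removes the first cell, so that
  the gap \<open>a\<close> enters only as a translation of the region in which the rest of the chain starts.
\<close>

primrec has_chain ::
  "nat \<times> nat \<Rightarrow> nat \<Rightarrow> (nat \<times> nat) set \<Rightarrow> (nat \<times> nat) set \<Rightarrow> bool" where
  "has_chain a 0 U S \<longleftrightarrow> S \<inter> U \<noteq> {}"
| "has_chain a (Suc k) U S \<longleftrightarrow> has_chain a k ((+) a ` beyond U S) S"

abbreviation cell_box :: "nat \<Rightarrow> nat \<Rightarrow> (nat \<times> nat) set" where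
  "cell_box m n \<equiv> {..<m} \<times> {..<n}"

lemma mem_translate_iff:
  fixes a z :: "nat \<times> nat"
  shows "z \<in> (+) a ` W \<longleftrightarrow>
    fst a \<le> fst z \<and> snd a \<le> snd z \<and> (fst z - fst a, snd z - snd a) \<in> W"
proof
  assume r: "fst a \<le> fst z \<and> snd a \<le> snd z \<and> (fst z - fst a, snd z - snd a) \<in> W"
  then have "z = a + (fst z - fst a, snd z - snd a)" by (simp add: prod_eq_iff)
  with r show "z \<in> (+) a ` W" by blast
qed auto

lemma up_closed_beyond: "up_closed (beyond U S)"
  unfolding up_closed_def beyond_def by (fastforce intro: less_le_trans)

lemma up_closed_translate:
  assumes "up_closed W"
  shows "up_closed ((+) a ` W)"
  unfolding up_closed_def mem_translate_iff
proof (intro ballI allI impI, goal_cases)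
  case (1 z z')
  then have "fst z - fst a \<le> fst z' - fst a" "snd z - snd a \<le> snd z' - snd a"
    "(fst z - fst a, snd z - snd a) \<in> W" "fst a \<le> fst z'" "snd a \<le> snd z'"
    by (auto simp: mem_translate_iff)
  with assms show ?case unfolding up_closed_def by fastforce
qed

lemma translate_subset:
  assumes "up_closed W"
  shows "(+) a ` W \<subseteq> W"
proof
  fix z assume "z \<in> (+) a ` W"
  then obtain w where "w \<in> W" "z = a + w" by blast
  moreover from this have "fst w \<le> fst z" "snd w \<le> snd z" by auto
  ultimately show "z \<in> W" using assms unfolding up_closed_def by blast
qed

lemma beyond_subset:
  assumes "up_closed U"
  shows "beyond U S \<subseteq> U"
  using assms by (fastforce simp: up_closed_def beyond_def)

text \<open>
  A chain cannot leave an up-closed region in which it starts.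
\<close>

lemma has_chain_Int_subset:
  assumes "up_closed U" "U \<subseteq> W"
  shows "has_chain a k U (S \<inter> W) \<longleftrightarrow> has_chain a k U S"
  using assms
proof (induction k arbitrary: U)
  case 0
  then show ?case by auto
next
  case (Suc k)
  have "beyond U (S \<inter> W) = beyond U S"
    using Suc.prems unfolding beyond_def by blast
  moreover have "(+) a ` beyond U S \<subseteq> W"
    using translate_subset[OF up_closed_beyond] beyond_subset[OF Suc.prems(1)] Suc.prems(2)
    by blast
  ultimately show ?case
    using Suc.IH up_closed_translate[OF up_closed_beyond] by simp
qed

lemma has_chain_start_cong:
  assumes "S \<subseteq> B" "U \<inter> B = U' \<inter> B"
  shows "has_chain a k U S \<longleftrightarrow> has_chain a k U' S"
proof -
  have "S \<inter> U = S \<inter> U'" using assms by blast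
  then show ?thesis by (cases k) (auto simp: beyond_def)
qed

lemma has_chain_translate:
  "has_chain b k ((+) a ` U) ((+) a ` S) \<longleftrightarrow> has_chain b k U S"
proof (induction k arbitrary: U)
  case 0
  then show ?case by auto
next
  case (Suc k)
  have "z \<in> beyond ((+) a ` U) ((+) a ` S) \<longleftrightarrow> z \<in> (+) a ` beyond U S" for z
  proof
    assume "z \<in> beyond ((+) a ` U) ((+) a ` S)"
    then obtain p where "p \<in> S \<inter> U" "fst (a + p) < fst z" "snd (a + p) < snd z"
      by (auto simp: beyond_def)
    then show "z \<in> (+) a ` beyond U S"
      unfolding mem_translate_iff beyond_def by (auto intro!: bexI[of _ p])
  next
    assume "z \<in> (+) a ` beyond U S"
    then obtain p w where "z = a + w" "p \<in> S \<inter> U" "fst p < fst w" "snd p < snd w"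
      by (auto simp: beyond_def)
    then show "z \<in> beyond ((+) a ` U) ((+) a ` S)"
      unfolding beyond_def by (auto intro!: bexI[of _ "a + p"])
  qed
  then have "beyond ((+) a ` U) ((+) a ` S) = (+) a ` beyond U S" by blast
  then have "(+) b ` beyond ((+) a ` U) ((+) a ` S) = (+) a ` (+) b ` beyond U S"
    by (simp add: image_image add.left_commute)
  then show ?case using Suc.IH by simp
qed

text \<open>
  This is the stopping property of the exploration. Whether the region opened by the cells of
  \<open>S \<inter> U\<close> equals \<open>W\<close> can be decided without looking at \<open>S\<close> inside \<open>W\<close>: the region is generated by the
  minimal cells of \<open>S \<inter> U\<close>, and a cell inside the region is not minimal.
\<close>

lemma beyond_eq_iff_outside:
  assumes "up_closed W"
  shows "beyond U (S - W) = W \<longleftrightarrow> beyond U S = W"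
proof
  assume eq: "beyond U (S - W) = W"
  have "z \<in> W" if "z \<in> beyond U S" for z
  proof -
    from that obtain p where p: "p \<in> S \<inter> U" "fst p < fst z" "snd p < snd z"
      by (auto simp: beyond_def)
    show ?thesis
    proof (cases "p \<in> W")
      case True
      with assms p show ?thesis unfolding up_closed_def by (meson less_imp_le)
    next
      case False
      with p have "z \<in> beyond U (S - W)" by (auto simp: beyond_def)
      with eq show ?thesis by simp
    qed
  qed
  moreover have "W \<subseteq> beyond U S" using eq by (auto simp: beyond_def)
  ultimately show "beyond U S = W" by blast
next
  assume eq: "beyond U S = W"
  have "z \<in> beyond U (S - W)" if "z \<in> W" for z
  proof -
    let ?below = "\<lambda>p. p \<in> S \<inter> U \<and> fst p < fst z \<and> snd p < snd z"
    from that eq obtain q where "?below q" by (auto simp: beyond_def)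
    \<comment> \<open>A leftmost cell suffices: a cell beyond another one is strictly to its right.\<close>
    then obtain p where p: "?below p" and least: "\<And>q. ?below q \<Longrightarrow> fst p \<le> fst q"
      using ex_has_least_nat[of ?below q fst] by blast
    have "p \<notin> W"
    proof
      assume "p \<in> W"
      with eq obtain q where "q \<in> S \<inter> U" "fst q < fst p" "snd q < snd p"
        by (auto simp: beyond_def)
      then show False using p least[of q] by simp
    qed
    with p show ?thesis by (auto simp: beyond_def)
  qed
  moreover have "beyond U (S - W) \<subseteq> W" using eq by (auto simp: beyond_def)
  ultimately show "beyond U (S - W) = W" by blast
qed

text \<open>
  The Markov property. Given that the first cells of chains open the region \<open>W\<close>, the chain continues
  in a translate of \<open>W\<close>, where the random set has not been inspected. Hence the rest of the chain may be
  sought in an independent copy \<open>T\<close> of the random set.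
\<close>

lemma has_chain_resample:
  assumes "finite G"
  shows "bernoulli_expectation p G (\<lambda>S. of_bool (has_chain a (Suc k) U S)) =
    bernoulli_expectation p G (\<lambda>S.
      bernoulli_expectation p G (\<lambda>T. of_bool (has_chain a k ((+) a ` beyond U S) T)))"
    (is "?lhs = ?rhs")
proof -
  define \<W> where "\<W> = beyond U ` Pow G"
  have fin: "finite \<W>" using assms by (simp add: \<W>_def)
  let ?f = "\<lambda>W S. of_bool (beyond U S = W) :: real"
  let ?g = "\<lambda>W S. of_bool (has_chain a k ((+) a ` W) S) :: real"
  have split: "F (beyond U S) = (\<Sum>W\<in>\<W>. ?f W S * F W)" if "S \<subseteq> G" for S and F :: "_ \<Rightarrow> real"
  proof -
    have "(\<Sum>W\<in>\<W>. ?f W S * F W) = (\<Sum>W\<in>\<W>. if beyond U S = W then F W else 0)"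
      by (intro sum.cong) auto
    also have "\<dots> = F (beyond U S)"
      using fin that by (simp add: \<W>_def)
    finally show ?thesis ..
  qed
  have indep: "bernoulli_expectation p G (\<lambda>S. ?f W S * ?g W S) =
      bernoulli_expectation p G (?f W) * bernoulli_expectation p G (?g W)" if "W \<in> \<W>" for W
  proof -
    have W: "up_closed W" using that up_closed_beyond by (auto simp: \<W>_def)
    show ?thesis
      using assms beyond_eq_iff_outside[OF W]
        has_chain_Int_subset[OF up_closed_translate[OF W] translate_subset[OF W]]
      by (intro bernoulli_expectation_indep[where W = W]) auto
  qed
  have "?lhs = bernoulli_expectation p G (\<lambda>S. \<Sum>W\<in>\<W>. ?f W S * ?g W S)"
    by (intro bernoulli_expectation_cong) (simp add: split[where F = "\<lambda>W. ?g W _", symmetric])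
  also have "\<dots> = bernoulli_expectation p G (\<lambda>S. \<Sum>W\<in>\<W>. ?f W S * bernoulli_expectation p G (?g W))"
    unfolding bernoulli_expectation_sum bernoulli_expectation_mult_right
    using indep by (intro sum.cong) auto
  also have "\<dots> = ?rhs"
    by (intro bernoulli_expectation_cong)
      (simp add: split[where F = "\<lambda>W. bernoulli_expectation p G (?g W)", symmetric])
  finally show ?thesis .
qed

text \<open>
  Translating the starting region has the same effect as shortening the box, since the cells outside
  the range of the translation cannot belong to the chain.
\<close>

lemma has_chain_expectation_translate:
  assumes "up_closed W"
  shows "bernoulli_expectation p (cell_box m n) (\<lambda>T. of_bool (has_chain b k ((+) a ` W) T)) =
    bernoulli_expectation p (cell_box (m - fst a) (n - snd a)) (\<lambda>T. of_bool (has_chain b k W T))"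
proof -
  have R: "cell_box m n \<inter> range ((+) a) = (+) a ` cell_box (m - fst a) (n - snd a)"
    by (auto simp only: set_eq_iff Int_iff mem_translate_iff mem_Times_iff lessThan_iff UNIV_I
        fst_conv snd_conv)
  have "bernoulli_expectation p (cell_box m n) (\<lambda>T. of_bool (has_chain b k ((+) a ` W) T)) =
      bernoulli_expectation p (cell_box m n)
        (\<lambda>T. of_bool (has_chain b k ((+) a ` W) (T \<inter> (cell_box m n \<inter> range ((+) a)))))"
  proof (rule bernoulli_expectation_cong)
    fix T assume "T \<subseteq> cell_box m n"
    then have "T \<inter> (cell_box m n \<inter> range ((+) a)) = T \<inter> range ((+) a)" by auto
    then show "of_bool (has_chain b k ((+) a ` W) T) =
        (of_bool (has_chain b k ((+) a ` W) (T \<inter> (cell_box m n \<inter> range ((+) a)))) :: real)"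
      using has_chain_Int_subset[OF up_closed_translate[OF assms], of a "range ((+) a)" b k T]
      by auto
  qed
  also have "\<dots> = bernoulli_expectation p (cell_box m n \<inter> range ((+) a))
      (\<lambda>T. of_bool (has_chain b k ((+) a ` W) T))"
    by (rule bernoulli_expectation_restrict
        [where f = "\<lambda>T. of_bool (has_chain b k ((+) a ` W) T)"]) auto
  also have "\<dots> = bernoulli_expectation p (cell_box (m - fst a) (n - snd a))
      (\<lambda>T. of_bool (has_chain b k W T))"
    unfolding R by (subst bernoulli_expectation_image) (auto simp: has_chain_translate)
  finally show ?thesis .
qed

text \<open>
  The discrete form of the theorem, and the heart of the proof. After resampling, the gap only
  translates the region in which the rest of the chain starts, and this translation can be traded for a
  smaller box. Each of the \<open>k\<close> steps of the chain therefore costs a translation of the box by \<open>a\<close>.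
\<close>

lemma has_chain_expectation_gap:
  "bernoulli_expectation p (cell_box m n) (\<lambda>S. of_bool (has_chain a k U S)) =
   bernoulli_expectation p (cell_box (m - k * fst a) (n - k * snd a))
     (\<lambda>S. of_bool (has_chain 0 k U S))"
proof (induction k arbitrary: U)
  case 0
  then show ?case by simp
next
  case (Suc k)
  let ?B = "cell_box m n" and ?B' = "cell_box (m - Suc k * fst a) (n - Suc k * snd a)"
  let ?\<phi> = "\<lambda>W. bernoulli_expectation p ?B' (\<lambda>T. of_bool (has_chain 0 k W T))"
  have step: "bernoulli_expectation p ?B (\<lambda>T. of_bool (has_chain a k ((+) a ` beyond U S) T)) =
      ?\<phi> (beyond U S)" for S
    unfolding Suc.IH
    by (subst has_chain_expectation_translate[OF up_closed_beyond]) (simp add: add.commute)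
  \<comment> \<open>The first step was explored in the large box, but only its part in the small box matters.\<close>
  have local: "?\<phi> (beyond U S) = ?\<phi> (beyond U (S \<inter> ?B'))" for S
  proof (rule bernoulli_expectation_cong)
    fix T assume T: "T \<subseteq> ?B'"
    have eq: "beyond U S \<inter> ?B' = beyond U (S \<inter> ?B') \<inter> ?B'"
      by (fastforce simp: beyond_def)
    show "of_bool (has_chain 0 k (beyond U S) T) =
        (of_bool (has_chain 0 k (beyond U (S \<inter> ?B')) T) :: real)"
      by (simp only: has_chain_start_cong[OF T eq])
  qed
  have "bernoulli_expectation p ?B (\<lambda>S. of_bool (has_chain a (Suc k) U S)) =
      bernoulli_expectation p ?B (\<lambda>S. ?\<phi> (beyond U S))"
    by (subst has_chain_resample) (simp_all only: step finite_cartesian_product finite_lessThan)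
  also have "\<dots> = bernoulli_expectation p ?B (\<lambda>S. ?\<phi> (beyond U (S \<inter> ?B')))"
    by (rule bernoulli_expectation_cong) (rule local)
  also have "\<dots> = bernoulli_expectation p ?B' (\<lambda>S. ?\<phi> (beyond U S))"
    by (rule bernoulli_expectation_restrict[where f = "\<lambda>S. ?\<phi> (beyond U S)"]) auto
  also have "\<dots> = bernoulli_expectation p ?B' (\<lambda>S. of_bool (has_chain 0 (Suc k) U S))"
    by (subst has_chain_resample) (simp_all del: has_chain.simps)
  finally show ?case .
qed

lemma has_chain_iff_list:
  "has_chain a k U S \<longleftrightarrow> (\<exists>cs. length cs = Suc k \<and> set cs \<subseteq> S \<and> hd cs \<in> U \<and>
    successively (\<lambda>c d. fst c + fst a + 1 \<le> fst d \<and> snd c + snd a + 1 \<le> snd d) cs)"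
    (is "_ \<longleftrightarrow> (\<exists>cs. ?C k U cs)")
proof (induction k arbitrary: U)
  case 0
  show ?case
  proof
    assume "has_chain a 0 U S"
    then obtain c where "c \<in> S" "c \<in> U" by auto
    then show "\<exists>cs. ?C 0 U cs" by (intro exI[of _ "[c]"]) auto
  next
    assume "\<exists>cs. ?C 0 U cs"
    then show "has_chain a 0 U S" by (auto simp: length_Suc_conv)
  qed
next
  case (Suc k)
  let ?V = "(+) a ` beyond U S"
  have V: "d \<in> ?V \<longleftrightarrow> (\<exists>c\<in>S \<inter> U. fst c + fst a + 1 \<le> fst d \<and> snd c + snd a + 1 \<le> snd d)" for d
  proof -
    have "fst a \<le> fst d \<and> snd a \<le> snd d \<and> fst c < fst d - fst a \<and> snd c < snd d - snd a \<longleftrightarrow>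
        fst c + fst a + 1 \<le> fst d \<and> snd c + snd a + 1 \<le> snd d" for c :: "nat \<times> nat"
      by auto
    then show ?thesis unfolding mem_translate_iff beyond_def by (simp flip: ex_simps) metis
  qed
  show ?case
  proof
    assume "has_chain a (Suc k) U S"
    with Suc.IH obtain cs where cs: "?C k ?V cs" by auto
    with V obtain c where "c \<in> S" "c \<in> U"
      "fst c + fst a + 1 \<le> fst (hd cs) \<and> snd c + snd a + 1 \<le> snd (hd cs)" by blast
    with cs have "?C (Suc k) U (c # cs)" by (auto simp: successively_Cons)
    then show "\<exists>cs. ?C (Suc k) U cs" by blast
  next
    assume "\<exists>cs. ?C (Suc k) U cs"
    then obtain cs' where cs': "?C (Suc k) U cs'" ..
    then obtain c cs where "cs' = c # cs" by (cases cs') auto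
    with cs' have "?C (Suc k) U (c # cs)" by simp
    then have "?C k ?V cs" unfolding V by (cases cs) auto
    with Suc.IH show "has_chain a (Suc k) U S" by auto
  qed
qed

section \<open>The grid of mesh 1/n\<close>

text \<open>
  Cells are half-open intervals \<open>(i/n, (i+1)/n]\<close>, and \<open>cell_index n y\<close> is the \<open>i\<close> of the cell of
  \<open>y > 0\<close>. A smaller index forces a smaller coordinate, so the cells with an index below that of \<open>x\<close>
  lie entirely to the left of \<open>x\<close>.
\<close>

definition cell_index :: "nat \<Rightarrow> real \<Rightarrow> nat" where
  "cell_index n y = nat (\<lceil>real n * y\<rceil> - 1)"

definition cell_of :: "nat \<Rightarrow> real \<times> real \<Rightarrow> nat \<times> nat" where
  "cell_of n p = (cell_index n (fst p), cell_index n (snd p))"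

definition cell :: "nat \<Rightarrow> nat \<times> nat \<Rightarrow> (real \<times> real) set" where
  "cell n c = {real (fst c) / real n<..real (fst c + 1) / real n} \<times>
    {real (snd c) / real n<..real (snd c + 1) / real n}"

text \<open>
  The probability that a cell of area \<open>1 / n\<^sup>2\<close> contains a point of a Poisson process of intensity
  \<open>1\<close>.
\<close>

definition cell_prob :: "nat \<Rightarrow> real" where
  "cell_prob n = 1 - exp (- (1 / (real n)\<^sup>2))"

text \<open>
  The gap in grid units is rounded down and lowered by one (not below zero): chains of cells have to
  advance by more than the grid gap, and the cells of points with \<open>y < y'\<close> and
  \<open>y + h \<le> y'\<close> must do so on every fine grid.
\<close>

definition grid_gap :: "nat \<Rightarrow> real \<Rightarrow> nat" where
  "grid_gap n h = nat \<lfloor>real n * h\<rfloor> - 1"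

lemma cell_index_mono: "y \<le> y' \<Longrightarrow> cell_index n y \<le> cell_index n y'"
  unfolding cell_index_def by (intro nat_mono diff_right_mono ceiling_mono mult_left_mono) auto

lemma cell_index_eq_iff:
  assumes "n > 0" "y > 0"
  shows "cell_index n y = i \<longleftrightarrow> real i / real n < y \<and> y \<le> real (i + 1) / real n"
proof -
  have "\<lceil>real n * y\<rceil> \<ge> 1" using assms by (simp add: one_le_ceiling)
  then have "cell_index n y = i \<longleftrightarrow> \<lceil>real n * y\<rceil> = int i + 1"
    unfolding cell_index_def by linarith
  also have "\<dots> \<longleftrightarrow> real i < real n * y \<and> real n * y \<le> real i + 1"
    by (simp add: ceiling_eq_iff)
  finally show ?thesis using assms by (simp add: field_simps)
qed

lemma mem_cell_iff:
  assumes "n > 0" "p \<in> quadrant"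
  shows "p \<in> cell n c \<longleftrightarrow> cell_of n p = c"
proof -
  have "fst p > 0" "snd p > 0" using assms(2) by (simp_all add: mem_Times_iff)
  with assms(1) show ?thesis
    unfolding cell_def cell_of_def mem_Times_iff greaterThanAtMost_iff prod_eq_iff fst_conv snd_conv
    by (simp only: cell_index_eq_iff)
qed

lemma cell_subset_quadrant: "cell n c \<subseteq> quadrant"
proof
  fix p assume p: "p \<in> cell n c"
  have "real (fst c) / real n \<ge> 0" "real (snd c) / real n \<ge> 0" by simp_all
  with p show "p \<in> quadrant"
    unfolding cell_def mem_Times_iff greaterThanAtMost_iff greaterThan_iff by linarith
qed

lemma cell_borel: "cell n c \<in> sets borel"
  unfolding cell_def by (intro borel_Times) auto

lemma cell_bounded: "bounded (cell n c)"
  unfolding cell_def by (intro bounded_Times) auto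

lemma cell_disjoint:
  assumes "n > 0" "c \<noteq> d"
  shows "cell n c \<inter> cell n d = {}"
proof -
  have False if "p \<in> cell n c" "p \<in> cell n d" for p
    using that assms(2) mem_cell_iff[OF assms(1) subsetD[OF cell_subset_quadrant that(1)]] by simp
  then show ?thesis by blast
qed

lemma measure_lborel_Times:
  fixes A B :: "real set"
  assumes "A \<in> sets borel" "B \<in> sets borel"
  shows "measure lborel (A \<times> B) = measure lborel A * measure lborel B"
proof -
  have "emeasure lborel (A \<times> B) = emeasure lborel A * emeasure lborel B"
    unfolding lborel_prod[symmetric] using assms
    by (intro lborel.emeasure_pair_measure_Times) auto
  then show ?thesis by (simp add: measure_def enn2real_mult)
qed

lemma measure_cell:
  shows "measure lborel (cell n c) = 1 / (real n)\<^sup>2"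
proof -
  have "measure lborel {real i / real n<..real (i + 1) / real n} = 1 / real n" for i
    by (simp add: divide_right_mono flip: diff_divide_distrib)
  then show ?thesis
    unfolding cell_def by (simp add: measure_lborel_Times power2_eq_square del: measure_lborel_Ioc)
qed

lemma cell_index_asymp:
  assumes "y > 0"
  shows "(\<lambda>n. real (cell_index n y) / real n) \<longlonglongrightarrow> y"
proof (rule tendsto_sandwich)
  show "\<forall>\<^sub>F n in sequentially. y - 1 / real n \<le> real (cell_index n y) / real n"
    using eventually_gt_at_top[of 0]
  proof eventually_elim
    case (elim n)
    have "y \<le> real (cell_index n y + 1) / real n"
      using cell_index_eq_iff[OF elim assms, of "cell_index n y"] by simp
    then show ?case by (simp add: add_divide_distrib)
  qed
  show "\<forall>\<^sub>F n in sequentially. real (cell_index n y) / real n \<le> y"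
    using eventually_gt_at_top[of 0]
  proof eventually_elim
    case (elim n)
    then show ?case using cell_index_eq_iff[of n y "cell_index n y"] assms by simp
  qed
  show "(\<lambda>n. y - 1 / real n) \<longlonglongrightarrow> y" by real_asymp
qed simp

lemma grid_gap_asymp:
  assumes "h \<ge> 0"
  shows "(\<lambda>n. real (grid_gap n h) / real n) \<longlonglongrightarrow> h"
proof (rule tendsto_sandwich)
  have *: "real n * h - 2 \<le> real (grid_gap n h)" "real (grid_gap n h) \<le> real n * h" for n
  proof -
    have "\<lfloor>real n * h\<rfloor> \<ge> 0" using assms by simp
    then have "real (grid_gap n h) = of_int (max 0 (\<lfloor>real n * h\<rfloor> - 1))"
      unfolding grid_gap_def by linarith
    moreover have "real n * h - 1 < of_int \<lfloor>real n * h\<rfloor>" "of_int \<lfloor>real n * h\<rfloor> \<le> real n * h"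
      "0 \<le> real n * h"
      using assms by (linarith, linarith, simp)
    ultimately show "real n * h - 2 \<le> real (grid_gap n h)" "real (grid_gap n h) \<le> real n * h"
      by linarith+
  qed
  show "\<forall>\<^sub>F n in sequentially. h - 2 / real n \<le> real (grid_gap n h) / real n"
    using eventually_gt_at_top[of 0]
  proof eventually_elim
    case (elim n)
    then show ?case
      using divide_right_mono[OF *(1)[of n], of "real n"] by (simp add: diff_divide_distrib)
  qed
  show "\<forall>\<^sub>F n in sequentially. real (grid_gap n h) / real n \<le> h"
    using eventually_gt_at_top[of 0]
  proof eventually_elim
    case (elim n)
    then show ?case using *[of n] by (simp add: field_simps)
  qed
  show "(\<lambda>n. h - 2 / real n) \<longlonglongrightarrow> h" by real_asymp
qed simp

text \<open>
  After division by \<open>n\<close> both sides converge to those of the inequality on the right. Ties are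
  excluded, because they could be resolved either way by rounding.
\<close>

lemma eventually_cell_index_shift_iff:
  assumes "y > 0" "y' > 0" "h \<ge> 0" "y + real k * h \<noteq> y'"
  shows "\<forall>\<^sub>F n in sequentially.
    cell_index n y + k * grid_gap n h + 1 \<le> cell_index n y' \<longleftrightarrow> y + real k * h < y'"
proof -
  let ?l = "\<lambda>n. real (cell_index n y) / real n + real k * (real (grid_gap n h) / real n) + 1 / real n"
  let ?r = "\<lambda>n. real (cell_index n y') / real n"
  have "(\<lambda>n. 1 / real n) \<longlonglongrightarrow> 0" by real_asymp
  then have "?l \<longlonglongrightarrow> y + real k * h + 0"
    using assms by (intro tendsto_intros cell_index_asymp grid_gap_asymp)
  then have l: "?l \<longlonglongrightarrow> y + real k * h" by simp
  have r: "?r \<longlonglongrightarrow> y'" using assms by (intro cell_index_asymp)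
  have eq: "cell_index n y + k * grid_gap n h + 1 \<le> cell_index n y' \<longleftrightarrow> ?l n \<le> ?r n" if "n > 0" for n
  proof -
    have "?l n = real (cell_index n y + k * grid_gap n h + 1) / real n"
      by (simp add: add_divide_distrib)
    then have "?l n \<le> ?r n \<longleftrightarrow>
        real (cell_index n y + k * grid_gap n h + 1) \<le> real (cell_index n y')"
      using that by (simp add: divide_le_cancel)
    then show ?thesis by (simp only: of_nat_le_iff)
  qed
  show ?thesis
  proof (cases "y + real k * h < y'")
    case True
    with order_tendstoD(1)[OF tendsto_diff[OF r l], of 0]
    have "\<forall>\<^sub>F n in sequentially. 0 < ?r n - ?l n" by simp
    with eventually_gt_at_top[of 0] show ?thesis
      by eventually_elim (use eq True in auto)
  next
    case False
    with assms(4) order_tendstoD(2)[OF tendsto_diff[OF r l], of 0]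
    have "\<forall>\<^sub>F n in sequentially. ?r n - ?l n < 0" by simp
    with eventually_gt_at_top[of 0] show ?thesis
      by eventually_elim (use eq False in auto)
  qed
qed

text \<open>
  For a single gap ties cause no trouble: this is what the rounding in \<^const>\<open>grid_gap\<close> is chosen for.
  So fine grids see exactly the relation between successive points of a path.
\<close>

lemma eventually_cell_index_gap_iff:
  assumes "y > 0" "y' > 0" "h \<ge> 0"
  shows "\<forall>\<^sub>F n in sequentially.
    cell_index n y + grid_gap n h + 1 \<le> cell_index n y' \<longleftrightarrow> y < y' \<and> y + h \<le> y'"
proof (cases "y + h = y'")
  case False
  then show ?thesis
    using eventually_cell_index_shift_iff[of y y' h 1] assms
    by (auto elim!: eventually_mono)
next
  case eq: True
  show ?thesis
  proof (cases "h = 0")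
    case True
    with eq show ?thesis by simp
  next
    case False
    have "\<forall>\<^sub>F n in sequentially. real n * h \<ge> 1"
      using False assms(3) by real_asymp
    with eventually_gt_at_top[of 0] show ?thesis
    proof eventually_elim
      case (elim n)
      \<comment> \<open>For a tie, rounding the gap down errs in favour of the chain.\<close>
      have "\<lceil>real n * y\<rceil> + \<lfloor>real n * h\<rfloor> \<le> \<lceil>real n * y'\<rceil>"
        unfolding eq[symmetric] distrib_left by linarith
      moreover have "\<lceil>real n * y\<rceil> \<ge> 1" using assms elim by (simp add: one_le_ceiling)
      moreover have "\<lfloor>real n * h\<rfloor> \<ge> 1" using elim by linarith
      ultimately have "cell_index n y + grid_gap n h + 1 \<le> cell_index n y'"
        unfolding cell_index_def grid_gap_def by linarith
      then show ?case using eq False assms by auto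
    qed
  qed
qed

section \<open>Chains of cells and paths of points\<close>

lemma ex_list_image_iff:
  "(\<exists>ys. P ys \<and> set ys \<subseteq> f ` A) \<longleftrightarrow> (\<exists>xs. P (map f xs) \<and> set xs \<subseteq> A)"
proof
  assume "\<exists>ys. P ys \<and> set ys \<subseteq> f ` A"
  then obtain ys where "P ys" "ys \<in> lists (f ` A)" by (auto simp: lists_eq_set)
  then obtain xs where "xs \<in> lists A" "ys = map f xs" unfolding lists_image by blast
  with \<open>P ys\<close> show "\<exists>xs. P (map f xs) \<and> set xs \<subseteq> A" by (auto simp: lists_eq_set)
next
  assume "\<exists>xs. P (map f xs) \<and> set xs \<subseteq> A"
  then obtain xs where "P (map f xs)" "set xs \<subseteq> A" by blast
  moreover from this have "set (map f xs) \<subseteq> f ` A" by auto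
  ultimately show "\<exists>ys. P ys \<and> set ys \<subseteq> f ` A" by blast
qed

lemma eventually_iff_const:
  assumes "F \<noteq> bot" "\<forall>\<^sub>F n in F. P n \<longleftrightarrow> b"
  shows "b \<longleftrightarrow> (\<forall>\<^sub>F n in F. P n)"
proof
  assume "\<forall>\<^sub>F n in F. P n"
  with assms(2) have "\<forall>\<^sub>F n in F. b" by eventually_elim simp
  with assms(1) show b by simp
qed (use assms(2) in simp)

lemma successively_conj:
  "successively (\<lambda>x y. P x y \<and> Q x y) xs \<longleftrightarrow> successively P xs \<and> successively Q xs"
  unfolding successively_conv_nth by auto

lemma gap_path_iff_successively:
  "gap_path A h z ps \<longleftrightarrow> set ps \<subseteq> A \<inter> {0<..<fst z} \<times> {0<..<snd z} \<and>
    successively (\<lambda>p q. (fst p < fst q \<and> fst p + fst h \<le> fst q) \<and>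
      (snd p < snd q \<and> snd p + snd h \<le> snd q)) ps"
proof -
  have "sorted_wrt (<) (map f ps) \<longleftrightarrow> successively (\<lambda>p q. f p < f q) ps"
    for f :: "real \<times> real \<Rightarrow> real"
    by (subst successively_conv_sorted_wrt[symmetric]) (auto simp: successively_map)
  then show ?thesis
    unfolding gap_path_def gap_prec_def successively_conj by auto
qed

lemma less_longest_gap_path_iff:
  assumes "finite (A \<inter> {0<..<fst z} \<times> {0<..<snd z})"
  shows "k < longest_gap_path A h z \<longleftrightarrow> (\<exists>ps. length ps = Suc k \<and> gap_path A h z ps)"
proof
  assume k: "k < longest_gap_path A h z"
  obtain ps where ps: "length ps = longest_gap_path A h z" "gap_path A h z ps"
    using longest_gap_path_attained(1)[OF assms] by blast
  have "gap_path A h z (take (Suc k) ps)"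
    using ps(2) unfolding gap_path_iff_successively
    by (auto simp: successively_conv_nth dest: in_set_takeD)
  moreover have "length (take (Suc k) ps) = Suc k" using k ps(1) by simp
  ultimately show "\<exists>ps. length ps = Suc k \<and> gap_path A h z ps" by blast
next
  assume "\<exists>ps. length ps = Suc k \<and> gap_path A h z ps"
  then show "k < longest_gap_path A h z"
    using longest_gap_path_attained(2)[OF assms] by (metis Suc_le_lessD)
qed

text \<open>
  On a fine grid, chains of occupied cells are the images of paths. Only the finitely many points of a
  window are concerned, so finitely many comparisons of indices have to agree with comparisons of
  coordinates. The box \<open>m n, m' n\<close> of cells may be any sequence that eventually separates the points
  below \<open>(c, d)\<close> from the others.
\<close>

lemma eventually_has_chain_iff:
  fixes A :: "(real \<times> real) set" and m m' :: "nat \<Rightarrow> nat"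
  assumes A: "A \<subseteq> quadrant" "finite (A \<inter> {0<..<x} \<times> {0<..<t})"
    and h: "h1 \<ge> 0" "h2 \<ge> 0" and cd: "c \<le> x" "d \<le> t"
    and m: "\<And>n. m n \<le> cell_index n x" "\<And>n. m' n \<le> cell_index n t"
    and ev: "\<And>p. p \<in> A \<inter> {0<..<x} \<times> {0<..<t} \<Longrightarrow>
        \<forall>\<^sub>F n in sequentially. cell_index n (fst p) < m n \<longleftrightarrow> fst p < c"
      "\<And>p. p \<in> A \<inter> {0<..<x} \<times> {0<..<t} \<Longrightarrow>
        \<forall>\<^sub>F n in sequentially. cell_index n (snd p) < m' n \<longleftrightarrow> snd p < d"
  shows "\<forall>\<^sub>F n in sequentially.
    has_chain (grid_gap n h1, grid_gap n h2) k UNIV (cell_of n ` A \<inter> cell_box (m n) (m' n)) \<longleftrightarrow>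
    k < longest_gap_path A (h1, h2) (c, d)"
proof -
  let ?F = "A \<inter> {0<..<x} \<times> {0<..<t}"
  define F' where "F' = A \<inter> {0<..<c} \<times> {0<..<d}"
  have F': "F' \<subseteq> ?F" using cd by (auto simp: F'_def)
  let ?near = "\<lambda>n p q. cell_index n (fst p) + grid_gap n h1 + 1 \<le> cell_index n (fst q) \<and>
    cell_index n (snd p) + grid_gap n h2 + 1 \<le> cell_index n (snd q)"
  let ?prec = "\<lambda>p q. (fst p < fst q \<and> fst p + h1 \<le> fst q) \<and> (snd p < snd q \<and> snd p + h2 \<le> snd q)"
  have "\<forall>\<^sub>F n in sequentially. ?near n p q \<longleftrightarrow> ?prec p q" if "p \<in> ?F" "q \<in> ?F" for p q
  proof -
    have pos: "fst p > 0" "fst q > 0" "snd p > 0" "snd q > 0" using that by auto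
    from eventually_cell_index_gap_iff[OF pos(1,2) h(1)]
      eventually_cell_index_gap_iff[OF pos(3,4) h(2)]
    show ?thesis by eventually_elim (simp only:)
  qed
  then have "\<forall>\<^sub>F n in sequentially. \<forall>p\<in>?F. \<forall>q\<in>?F. ?near n p q \<longleftrightarrow> ?prec p q"
    using A(2) by (intro eventually_ball_finite ballI) auto
  moreover have "\<forall>\<^sub>F n in sequentially. \<forall>p\<in>?F. cell_index n (fst p) < m n \<longleftrightarrow> fst p < c"
    using A(2) ev(1) by (intro eventually_ball_finite ballI) auto
  moreover have "\<forall>\<^sub>F n in sequentially. \<forall>p\<in>?F. cell_index n (snd p) < m' n \<longleftrightarrow> snd p < d"
    using A(2) ev(2) by (intro eventually_ball_finite ballI) auto
  ultimately show ?thesis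
  proof eventually_elim
    case (elim n)
    have in_F: "p \<in> ?F" if "p \<in> A" "cell_index n (fst p) < m n" "cell_index n (snd p) < m' n" for p
    proof -
      have "fst p < x" "snd p < t"
        using that(2,3) m[of n] cell_index_mono[of x "fst p" n] cell_index_mono[of t "snd p" n]
        by linarith+
      moreover have "p \<in> quadrant" using that(1) A(1) by blast
      ultimately show ?thesis using that(1) by (simp add: mem_Times_iff)
    qed
    have cells: "cell_of n ` A \<inter> cell_box (m n) (m' n) = cell_of n ` F'"
    proof -
      have "cell_of n p \<in> cell_box (m n) (m' n) \<longleftrightarrow> p \<in> F'" if "p \<in> A" for p
      proof
        assume "cell_of n p \<in> cell_box (m n) (m' n)"
        then have i: "cell_index n (fst p) < m n" "cell_index n (snd p) < m' n"
          by (auto simp: cell_of_def)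
        note F = in_F[OF that i]
        then show "p \<in> F'" using elim(2,3) i by (auto simp: F'_def mem_Times_iff)
      next
        assume "p \<in> F'"
        then have "p \<in> ?F" "fst p < c" "snd p < d" using F' by (auto simp: F'_def)
        then show "cell_of n p \<in> cell_box (m n) (m' n)"
          using elim(2,3) by (auto simp: cell_of_def)
      qed
      moreover have "F' \<subseteq> A" by (simp add: F'_def)
      ultimately have "F' = {p \<in> A. cell_of n p \<in> cell_box (m n) (m' n)}"
        by (simp only: set_eq_iff mem_Collect_eq subset_iff) metis
      moreover have "f ` A \<inter> B = f ` {p \<in> A. f p \<in> B}" for f :: "_ \<Rightarrow> nat \<times> nat" and B
        by blast
      ultimately show ?thesis by simp
    qed
    have "has_chain (grid_gap n h1, grid_gap n h2) k UNIV (cell_of n ` F') \<longleftrightarrow>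
        (\<exists>ps. length ps = Suc k \<and> set ps \<subseteq> F' \<and> successively (?near n) ps)"
    proof -
      show ?thesis
        unfolding has_chain_iff_list
        using ex_list_image_iff[of "\<lambda>cs. length cs = Suc k \<and>
          successively (\<lambda>c d. fst c + grid_gap n h1 + 1 \<le> fst d \<and>
            snd c + grid_gap n h2 + 1 \<le> snd d) cs" "cell_of n" F']
        by (simp add: successively_map cell_of_def conj_ac)
    qed
    also have "\<dots> \<longleftrightarrow> (\<exists>ps. length ps = Suc k \<and> set ps \<subseteq> F' \<and> successively ?prec ps)"
    proof -
      have "successively (?near n) ps \<longleftrightarrow> successively ?prec ps" if "set ps \<subseteq> F'" for ps
        using elim(1) F' that by (intro successively_cong refl) blast
      then show ?thesis by blast
    qed
    also have "\<dots> \<longleftrightarrow> (\<exists>ps. length ps = Suc k \<and> gap_path A (h1, h2) (c, d) ps)"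
      unfolding gap_path_iff_successively by (simp add: F'_def)
    also have "\<dots> \<longleftrightarrow> k < longest_gap_path A (h1, h2) (c, d)"
      by (subst less_longest_gap_path_iff) (use finite_subset[OF F' A(2)] in \<open>simp_all add: F'_def\<close>)
    finally show ?case unfolding cells .
  qed
qed

section \<open>Convergence of probabilities\<close>

lemma (in prob_space) prob_tendsto_of_AE_eventually_iff:
  assumes "\<And>n. E n \<in> events" "E' \<in> events"
    and "AE \<omega> in M. \<forall>\<^sub>F n in sequentially. \<omega> \<in> E n \<longleftrightarrow> \<omega> \<in> E'"
  shows "(\<lambda>n. prob (E n)) \<longlonglongrightarrow> prob E'"
proof -
  have "(\<lambda>n. \<integral>\<omega>. indicator (E n) \<omega> \<partial>M) \<longlonglongrightarrow> (\<integral>\<omega>. indicator E' \<omega> \<partial>M :: real)"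
  proof (rule integral_dominated_convergence[where w = "\<lambda>_. 1"])
    show "AE \<omega> in M. (\<lambda>n. indicator (E n) \<omega>) \<longlonglongrightarrow> (indicator E' \<omega> :: real)"
      using assms(3)
    proof eventually_elim
      case (elim \<omega>)
      then show ?case
        by (intro tendsto_eventually) (auto elim!: eventually_mono simp: indicator_def)
    qed
  qed (use assms in \<open>auto simp: indicator_def\<close>)
  then show ?thesis using assms by simp
qed

section \<open>Occupied cells of the Poisson process\<close>

locale quadrant_process = homogeneous_poisson_process M 1 quadrant \<Xi>
  for M :: "'w measure" and \<Xi> :: "'w \<Rightarrow> (real \<times> real) set"
begin

lemma finite_window:
  assumes "\<omega> \<in> space M"
  shows "finite (\<Xi> \<omega> \<inter> {0<..<x} \<times> {0<..<t})"
  by (intro locally_finite[OF assms] bounded_Times bounded_Ioo)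

lemma AE_no_points:
  assumes B: "B \<in> sets borel" "bounded B" "B \<subseteq> quadrant" and "measure lborel B = 0"
  shows "AE \<omega> in M. \<Xi> \<omega> \<inter> B = {}"
proof -
  have "prob {\<omega> \<in> space M. card (\<Xi> \<omega> \<inter> B) = 0} = 1"
    using count_poisson[OF B, of 0] assms(4) by simp
  from AE_prob_1[OF this] AE_space show ?thesis
    by eventually_elim (use locally_finite[OF _ B(2)] in simp)
qed

lemma occupied_iff:
  assumes "\<omega> \<in> space M" "n > 0"
  shows "c \<in> cell_of n ` \<Xi> \<omega> \<longleftrightarrow> card (\<Xi> \<omega> \<inter> cell n c) \<noteq> 0"
proof -
  have "c \<in> cell_of n ` \<Xi> \<omega> \<longleftrightarrow> \<Xi> \<omega> \<inter> cell n c \<noteq> {}"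
  proof -
    have "p \<in> cell n c \<longleftrightarrow> c = cell_of n p" if "p \<in> \<Xi> \<omega>" for p
      using mem_cell_iff[OF assms(2) subsetD[OF points_in_region[OF assms(1)] that]] by auto
    then show ?thesis by (auto simp only: image_iff disjoint_iff)
  qed
  then show ?thesis using locally_finite[OF assms(1) cell_bounded] by simp
qed

text \<open>
  The cells are disjoint, so they are occupied independently; the distribution of the occupied cells
  in \<open>G\<close> is therefore that of the random subset behind \<^const>\<open>bernoulli_expectation\<close>.
\<close>

lemma prob_occupied_pattern:
  assumes n: "n > 0" and G: "finite G" and S: "S \<subseteq> G"
  shows "{\<omega> \<in> space M. cell_of n ` \<Xi> \<omega> \<inter> G = S} \<in> events" (is "?E \<in> events")
    and "prob {\<omega> \<in> space M. cell_of n ` \<Xi> \<omega> \<inter> G = S} =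
      (\<Prod>c\<in>G. if c \<in> S then cell_prob n else 1 - cell_prob n)"
proof -
  let ?N = "\<lambda>c \<omega>. card (\<Xi> \<omega> \<inter> cell n c)"
  let ?V = "\<lambda>c. if c \<in> S then - {0} else {0::nat}"
  let ?ev = "\<lambda>c. ?N c -` ?V c \<inter> space M"
  have rv: "random_variable (count_space UNIV) (?N c)" for c
    using count_measurable[OF cell_borel cell_bounded cell_subset_quadrant] .
  have E: "?E = space M \<inter> (\<Inter>c\<in>G. ?ev c)"
  proof -
    have "cell_of n ` \<Xi> \<omega> \<inter> G = S \<longleftrightarrow> (\<forall>c\<in>G. ?N c \<omega> \<in> ?V c)" if "\<omega> \<in> space M" for \<omega>
      using S occupied_iff[OF that n] by (auto simp: set_eq_iff)
    then have "?E = {\<omega> \<in> space M. \<forall>c\<in>G. ?N c \<omega> \<in> ?V c}"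
      by (intro Collect_cong conj_cong refl)
    then show ?thesis by (simp only: set_eq_iff) blast
  qed
  have ev: "?ev c \<in> events" for c by (rule measurable_sets[OF rv]) simp
  then show "?E \<in> events"
    unfolding E by (cases "G = {}") (simp, intro sets.Int[OF sets.top] sets.finite_INT[OF G])
  have p0: "prob {\<omega> \<in> space M. ?N c \<omega> = 0} = 1 - cell_prob n" for c
    using count_poisson[OF cell_borel cell_bounded cell_subset_quadrant, of n c 0]
    by (simp add: measure_cell cell_prob_def)
  have p: "prob (?ev c) = (if c \<in> S then cell_prob n else 1 - cell_prob n)" for c
  proof (cases "c \<in> S")
    case False
    then have "?ev c = {\<omega> \<in> space M. ?N c \<omega> = 0}" by auto
    with False p0 show ?thesis by simp
  next
    case True
    have "{\<omega> \<in> space M. ?N c \<omega> = 0} = ?N c -` {0} \<inter> space M" by auto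
    then have "{\<omega> \<in> space M. ?N c \<omega> = 0} \<in> events" using measurable_sets[OF rv] by simp
    moreover have "?ev c = space M - {\<omega> \<in> space M. ?N c \<omega> = 0}" using True by auto
    ultimately show ?thesis using prob_compl p0 True by simp
  qed
  show "prob ?E = (\<Prod>c\<in>G. if c \<in> S then cell_prob n else 1 - cell_prob n)"
  proof (cases "G = {}")
    case True
    with S show ?thesis by (simp add: prob_space)
  next
    case False
    obtain e where e: "bij_betw e {..<card G} G"
      using ex_bij_betw_nat_finite[OF G] by (auto simp: atLeast0LessThan)
    have "disjoint_family_on (\<lambda>i. cell n (e i)) {..<card G}"
      unfolding disjoint_family_on_def
    proof (intro ballI impI)
      fix i j assume "i \<in> {..<card G}" "j \<in> {..<card G}" "i \<noteq> j"
      with bij_betw_imp_inj_on[OF e] have "e i \<noteq> e j" by (auto dest: inj_onD)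
      then show "cell n (e i) \<inter> cell n (e j) = {}" by (rule cell_disjoint[OF n])
    qed
    then have "indep_vars (\<lambda>_. count_space UNIV) (\<lambda>i. ?N (e i)) {..<card G}"
      using count_indep[of "card G" "\<lambda>i. cell n (e i)"] cell_borel cell_bounded cell_subset_quadrant
      by blast
    from indep_varsD_finite[OF this, of "\<lambda>i. ?V (e i)"] False G
    have "prob (\<Inter>i\<in>{..<card G}. ?ev (e i)) = (\<Prod>i\<in>{..<card G}. prob (?ev (e i)))"
      by (auto simp: card_gt_0_iff lessThan_empty_iff)
    also have "\<dots> = (\<Prod>c\<in>G. prob (?ev c))" by (rule prod.reindex_bij_betw[OF e])
    also have "(\<Inter>i\<in>{..<card G}. ?ev (e i)) = (\<Inter>c\<in>e ` {..<card G}. ?ev c)"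
      by (simp only: image_image)
    also have "e ` {..<card G} = G" by (rule bij_betw_imp_surj_on[OF e])
    also have "(\<Inter>c\<in>G. ?ev c) = ?E" unfolding E using False by blast
    finally show ?thesis unfolding p .
  qed
qed

lemma prob_occupied:
  assumes n: "n > 0" and G: "finite G"
  shows "{\<omega> \<in> space M. Q (cell_of n ` \<Xi> \<omega> \<inter> G)} \<in> events" (is "?E \<in> events")
    and "prob {\<omega> \<in> space M. Q (cell_of n ` \<Xi> \<omega> \<inter> G)} =
      bernoulli_expectation (cell_prob n) G (\<lambda>S. of_bool (Q S))"
proof -
  let ?P = "\<lambda>S. {\<omega> \<in> space M. cell_of n ` \<Xi> \<omega> \<inter> G = S}"
  let ?I = "{S \<in> Pow G. Q S}"
  have E: "?E = (\<Union>S\<in>?I. ?P S)" by auto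
  have ev: "?P S \<in> events" if "S \<in> ?I" for S
    using prob_occupied_pattern(1)[OF n G] that by auto
  have fin: "finite ?I" using G by simp
  from ev fin show "?E \<in> events" unfolding E by (intro sets.finite_UN) auto
  have "prob ?E = (\<Sum>S\<in>?I. prob (?P S))"
    unfolding E using fin ev
    by (intro finite_measure_finite_Union) (auto simp: disjoint_family_on_def)
  also have "\<dots> = (\<Sum>S\<in>?I. \<Prod>c\<in>G. if c \<in> S then cell_prob n else 1 - cell_prob n)"
    using prob_occupied_pattern(2)[OF n G] by (intro sum.cong) auto
  also have "\<dots> = bernoulli_expectation (cell_prob n) G (\<lambda>S. of_bool (Q S))"
    unfolding bernoulli_expectation_def using G by (intro sum.mono_neutral_cong_left) auto
  finally show "prob ?E = \<dots>" .
qed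

section \<open>Passage to the limit\<close>

abbreviation grid_chain :: "nat \<Rightarrow> nat \<times> nat \<Rightarrow> nat \<Rightarrow> nat \<Rightarrow> nat \<Rightarrow> 'w set" where
  "grid_chain n a k m m' \<equiv>
    {\<omega> \<in> space M. has_chain a k UNIV (cell_of n ` \<Xi> \<omega> \<inter> cell_box m m')}"

lemma prob_grid_chain_gap:
  assumes "n > 0"
  shows "prob (grid_chain n a k m m') = prob (grid_chain n 0 k (m - k * fst a) (m' - k * snd a))"
proof -
  have "prob (grid_chain n a k m m') =
      bernoulli_expectation (cell_prob n) (cell_box m m') (\<lambda>S. of_bool (has_chain a k UNIV S))"
    for a m m'
    by (rule prob_occupied(2)[OF assms]) simp
  then show ?thesis using has_chain_expectation_gap[of "cell_prob n" m m' a k UNIV] by simp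
qed

lemma eventually_grid_chain_iff:
  assumes "\<omega> \<in> space M" and h: "h1 \<ge> 0" "h2 \<ge> 0" and xt: "x > 0" "t > 0"
  shows "\<forall>\<^sub>F n in sequentially.
    \<omega> \<in> grid_chain n (grid_gap n h1, grid_gap n h2) k (cell_index n x) (cell_index n t) \<longleftrightarrow>
    k < longest_gap_path (\<Xi> \<omega>) (h1, h2) (x, t)"
proof -
  have lt: "\<forall>\<^sub>F n in sequentially. cell_index n y < cell_index n y' \<longleftrightarrow> y < y'"
    if "y > 0" "y' > 0" for y y'
    using eventually_cell_index_gap_iff[of y y' 0] that
    by (auto simp: grid_gap_def Suc_le_eq elim!: eventually_mono)
  have "\<forall>\<^sub>F n in sequentially. has_chain (grid_gap n h1, grid_gap n h2) k UNIV
      (cell_of n ` \<Xi> \<omega> \<inter> cell_box (cell_index n x) (cell_index n t)) \<longleftrightarrow>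
      k < longest_gap_path (\<Xi> \<omega>) (h1, h2) (x, t)"
  proof (rule eventually_has_chain_iff[OF points_in_region finite_window h])
    fix p assume "p \<in> \<Xi> \<omega> \<inter> {0<..<x} \<times> {0<..<t}"
    then have "fst p > 0" "snd p > 0" by auto
    then show "\<forall>\<^sub>F n in sequentially. cell_index n (fst p) < cell_index n x \<longleftrightarrow> fst p < x"
      "\<forall>\<^sub>F n in sequentially. cell_index n (snd p) < cell_index n t \<longleftrightarrow> snd p < t"
      using lt xt by blast+
  qed (use assms(1) in auto)
  then show ?thesis using assms(1) by simp
qed

text \<open>
  The event is, for every outcome, the limit of
  events about finitely many cells.
\<close>

lemma less_longest_gap_path_event:
  assumes "fst h \<ge> 0" "snd h \<ge> 0"
  shows "{\<omega> \<in> space M. k < longest_gap_path (\<Xi> \<omega>) h z} \<in> events"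
proof (cases "fst z > 0 \<and> snd z > 0")
  case False
  then have "longest_gap_path (\<Xi> \<omega>) h z = 0" for \<omega>
    by (intro longest_gap_path_degenerate) auto
  then show ?thesis by simp
next
  case True
  \<comment> \<open>The events with \<open>n = 0\<close>, where there is no grid, need not be measurable; hence \<open>Suc n\<close> below.\<close>
  let ?E = "\<lambda>n. grid_chain n (grid_gap n (fst h), grid_gap n (snd h)) k
    (cell_index n (fst z)) (cell_index n (snd z))"
  have iff: "k < longest_gap_path (\<Xi> \<omega>) h z \<longleftrightarrow> (\<forall>\<^sub>F n in sequentially. \<omega> \<in> ?E (Suc n))"
    if "\<omega> \<in> space M" for \<omega>
  proof -
    have "\<forall>\<^sub>F n in sequentially. \<omega> \<in> ?E (Suc n) \<longleftrightarrow> k < longest_gap_path (\<Xi> \<omega>) h z"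
      using eventually_grid_chain_iff[OF that assms, of "fst z" "snd z" k] True
      by (subst eventually_sequentially_Suc) simp
    then show ?thesis by (rule eventually_iff_const[OF sequentially_bot])
  qed
  have "{\<omega> \<in> space M. \<omega> \<in> ?E (Suc n)} \<in> events" for n
    using prob_occupied(1)[of "Suc n"] by simp
  then have "{\<omega> \<in> space M. \<forall>\<^sub>F n in sequentially. \<omega> \<in> ?E (Suc n)} \<in> events"
    by (rule sets_Collect_eventually_sequentially)
  moreover have "{\<omega> \<in> space M. k < longest_gap_path (\<Xi> \<omega>) h z} =
      {\<omega> \<in> space M. \<forall>\<^sub>F n in sequentially. \<omega> \<in> ?E (Suc n)}"
    using iff by blast
  ultimately show ?thesis by simp
qed

text \<open>
  The corner of the shrunk box of cells only approximates \<open>(x - h1 k, t - h2 k)\<close>, possibly from above,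
  so points with the same abscissa or ordinate as the corner could be misjudged. Almost surely there
  are none.
\<close>

lemma AE_eventually_shrunk_grid_chain_iff:
  assumes h: "h1 \<ge> 0" "h2 \<ge> 0" and xt: "x > 0" "t > 0"
  shows "AE \<omega> in M. \<forall>\<^sub>F n in sequentially.
    \<omega> \<in> grid_chain n 0 k (cell_index n x - k * grid_gap n h1) (cell_index n t - k * grid_gap n h2) \<longleftrightarrow>
    k < longest_path (\<Xi> \<omega>) (x - h1 * real k, t - h2 * real k)"
proof -
  let ?c = "x - h1 * real k" and ?d = "t - h2 * real k"
  have null: "measure lborel ({y} \<inter> {0<..}) = 0" for y :: real
    by (cases "y > 0") auto
  have "AE \<omega> in M. \<Xi> \<omega> \<inter> ({?c} \<inter> {0<..}) \<times> {0<..<t} = {}"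
    by (intro AE_no_points bounded_Times borel_Times) (auto simp: measure_lborel_Times null)
  moreover have "AE \<omega> in M. \<Xi> \<omega> \<inter> {0<..<x} \<times> ({?d} \<inter> {0<..}) = {}"
    by (intro AE_no_points bounded_Times borel_Times) (auto simp: measure_lborel_Times null)
  ultimately show ?thesis
    using AE_space
  proof eventually_elim
    case (elim \<omega>)
    have shift: "\<forall>\<^sub>F n in sequentially.
        cell_index n y < cell_index n y' - k * grid_gap n h \<longleftrightarrow> y < y' - h * real k"
      if "y > 0" "y' > 0" "h \<ge> 0" "y \<noteq> y' - h * real k" for y y' h
      using eventually_cell_index_shift_iff[of y y' h k] that
      by (auto simp: algebra_simps elim!: eventually_mono)
    have "\<forall>\<^sub>F n in sequentially. has_chain (grid_gap n 0, grid_gap n 0) k UNIV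
        (cell_of n ` \<Xi> \<omega> \<inter>
          cell_box (cell_index n x - k * grid_gap n h1) (cell_index n t - k * grid_gap n h2)) \<longleftrightarrow>
        k < longest_path (\<Xi> \<omega>) (?c, ?d)"
    proof (rule eventually_has_chain_iff[OF points_in_region finite_window])
      fix p assume p: "p \<in> \<Xi> \<omega> \<inter> {0<..<x} \<times> {0<..<t}"
      with elim(1,2) have "fst p \<noteq> ?c" "snd p \<noteq> ?d" by (auto simp: set_eq_iff)
      with p h xt show "\<forall>\<^sub>F n in sequentially.
          cell_index n (fst p) < cell_index n x - k * grid_gap n h1 \<longleftrightarrow> fst p < ?c"
        "\<forall>\<^sub>F n in sequentially.
          cell_index n (snd p) < cell_index n t - k * grid_gap n h2 \<longleftrightarrow> snd p < ?d"
        by (auto intro!: shift)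
    qed (use elim h in auto)
    moreover have "(grid_gap n 0, grid_gap n 0) = 0" for n
      by (simp add: grid_gap_def zero_prod_def)
    ultimately show ?case using elim(3) by simp
  qed
qed

text \<open>
  Both probabilities are limits along the grids, and \<open>prob_grid_chain_gap\<close> identifies the two
  sequences term by term.
\<close>

lemma prob_less_longest_gap_path:
  assumes h: "h1 \<ge> 0" "h2 \<ge> 0" and xt: "x > 0" "t > 0"
  shows "prob {\<omega> \<in> space M. k < longest_gap_path (\<Xi> \<omega>) (h1, h2) (x, t)} =
    prob {\<omega> \<in> space M. k < longest_path (\<Xi> \<omega>) (x - h1 * real k, t - h2 * real k)}"
proof -
  let ?E = "\<lambda>n. grid_chain n (grid_gap n h1, grid_gap n h2) k (cell_index n x) (cell_index n t)"
  let ?E' = "\<lambda>n. grid_chain n 0 k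
    (cell_index n x - k * grid_gap n h1) (cell_index n t - k * grid_gap n h2)"
  have "(\<lambda>n. prob (?E (Suc n))) \<longlonglongrightarrow>
      prob {\<omega> \<in> space M. k < longest_gap_path (\<Xi> \<omega>) (h1, h2) (x, t)}"
  proof (rule prob_tendsto_of_AE_eventually_iff)
    show "AE \<omega> in M. \<forall>\<^sub>F n in sequentially. \<omega> \<in> ?E (Suc n) \<longleftrightarrow>
        \<omega> \<in> {\<omega> \<in> space M. k < longest_gap_path (\<Xi> \<omega>) (h1, h2) (x, t)}"
      using AE_space
    proof eventually_elim
      case (elim \<omega>)
      from eventually_grid_chain_iff[OF this h xt, of k] elim show ?case
        by (subst eventually_sequentially_Suc) simp
    qed
  qed (use h in \<open>auto intro!: prob_occupied(1) less_longest_gap_path_event\<close>)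
  moreover have "(\<lambda>n. prob (?E' (Suc n))) \<longlonglongrightarrow>
      prob {\<omega> \<in> space M. k < longest_path (\<Xi> \<omega>) (x - h1 * real k, t - h2 * real k)}"
  proof (rule prob_tendsto_of_AE_eventually_iff)
    show "AE \<omega> in M. \<forall>\<^sub>F n in sequentially. \<omega> \<in> ?E' (Suc n) \<longleftrightarrow>
        \<omega> \<in> {\<omega> \<in> space M. k < longest_path (\<Xi> \<omega>) (x - h1 * real k, t - h2 * real k)}"
      using AE_eventually_shrunk_grid_chain_iff[OF h xt, of k] AE_space
    proof eventually_elim
      case (elim \<omega>)
      then show ?case by (subst eventually_sequentially_Suc) simp
    qed
  qed (auto intro!: prob_occupied(1) less_longest_gap_path_event)
  moreover have "prob (?E (Suc n)) = prob (?E' (Suc n))" for n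
    by (subst prob_grid_chain_gap) simp_all
  ultimately show ?thesis using LIMSEQ_unique by simp
qed

end

theorem theorem1:
  fixes M :: "'w measure"
    and \<Xi> :: "'w \<Rightarrow> (real \<times> real) set"
    and h1 h2 x t :: real
    and k :: nat
  assumes "homogeneous_poisson_process M 1 quadrant \<Xi>"
    and "h1 \<ge> 0" and "h2 \<ge> 0"
    and "x > 0" and "t > 0"
  shows "measure M {\<omega> \<in> space M. longest_gap_path (\<Xi> \<omega>) (h1, h2) (x, t) \<le> k} =
         measure M {\<omega> \<in> space M. longest_path (\<Xi> \<omega>) (x - h1 * real k, t - h2 * real k) \<le> k}"
proof -
  interpret quadrant_process M \<Xi>
    using assms(1) by (rule quadrant_process.intro)
  have compl: "prob {\<omega> \<in> space M. longest_gap_path (\<Xi> \<omega>) h z \<le> k} =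
      1 - prob {\<omega> \<in> space M. k < longest_gap_path (\<Xi> \<omega>) h z}"
    if "fst h \<ge> 0" "snd h \<ge> 0" for h z
  proof -
    have "{\<omega> \<in> space M. longest_gap_path (\<Xi> \<omega>) h z \<le> k} =
        space M - {\<omega> \<in> space M. k < longest_gap_path (\<Xi> \<omega>) h z}" by auto
    then show ?thesis using prob_compl[OF less_longest_gap_path_event[OF that]] by simp
  qed
  show ?thesis
    using prob_less_longest_gap_path[OF assms(2-5)] assms(2,3) by (simp add: compl)
qed

end
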